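(* Let $a,b>0$, let $n_2,n_3$ be positive integers, and let $\mathbf{d}_2=(d_{1,2},\ldots,d_{n_2,2})$ and $\mathbf{d}_3=(d_{1,3},\ldots,d_{n_3,3})$ be vectors of positive reals. Let $\mathcal{F}_1,\mathcal{F}_2,\mathcal{F}_3$ be the free linkages in the plane with length vectors $(a,b)$, $\mathbf{d}_2$, $\mathbf{d}_3$ respectively. Put $$D_2=\{\pm d_{1,2}\pm\cdots\pm d_{n_2,2}\},\qquad D_3=\{\pm d_{1,3}\pm\cdots\pm d_{n_3,3}\},\qquad D=\{|a-b|,\,a+b\},$$ where in $D_2$ and $D_3$ all choices of signs are taken. Suppose that $$a+b<\min\Big\{\sum_{j=1}^{n_2}d_{j,2},\ \sum_{j=1}^{n_3}d_{j,3}\Big\}$$ and that one of the following conditions is met: (1) the sets $D_2$, $D_3$ and $D$ are pairwise disjoint; (2) $D_2$ and $D_3$ have nonempty intersection, but the sets $[\,|a-b|,a+b\,]\cap(D_2\cap D_3)$ and $D\cap(D_2\cup D_3)$ are empty. Then the moduli space $M(\mathcal{F}_1,\mathcal{F}_2,\mathcal{F}_3)$ is a smooth manifold of dimension $n_2+n_3-3$.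
   Context: A free linkage in $\mathbb{R}^2$ with length vector $(d_1,\ldots,d_n)$, $d_i>0$, has configurations $(x_1,\ldots,x_{n+1})\in(\mathbb{R}^2)^{n+1}$ with $|x_i-x_{i+1}|=d_i$ for $i=1,\ldots,n$; $x_1$ is the initial and $x_{n+1}$ the terminal vertex. $C(\mathcal{F}_1,\mathcal{F}_2,\mathcal{F}_3)$ is the space of triples of configurations of $\mathcal{F}_1,\mathcal{F}_2,\mathcal{F}_3$ with all initial vertices at the origin and all terminal vertices coinciding, and $M(\mathcal{F}_1,\mathcal{F}_2,\mathcal{F}_3)=C(\mathcal{F}_1,\mathcal{F}_2,\mathcal{F}_3)/SO(2)$. It is identified with the set of triples in which the first edge of $\mathcal{F}_1$ lies on the positive $x$-axis. Equivalently, writing $\theta_{i,j}\in\mathbb{R}/2\pi\mathbb{Z}$ for the angle from the positive $x$-axis to the $i$-th edge of $\mathcal{F}_j$ (with $\theta_{1,1}=0$), it is the zero set, in the torus of the remaining angle variables, of the equations saying that the sum of the edge vectors of $\mathcal{F}_1$ equals the sum of the edge vectors of $\mathcal{F}_2$ and equals the sum of the edge vectors of $\mathcal{F}_3$. *)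

theory Defs
  imports "HOL-Analysis.Analysis"
begin

text \<open>Smooth (i.e. \<open>C\<^sup>\<infinity>\<close>) maps, meant for open sets \<open>S\<close> in finite-dimensional spaces, and embedded
  smooth submanifolds without boundary, given by slice charts. The Hausdorff property and second
  countability are inherited from the ambient space. The dimension is an integer, so a set that is
  a submanifold of negative dimension is empty.\<close>

fun C_k_on :: "nat \<Rightarrow> 'a::real_normed_vector set \<Rightarrow> ('a \<Rightarrow> 'b::real_normed_vector) \<Rightarrow> bool" where
  "C_k_on 0 S f \<longleftrightarrow> continuous_on S f"
| "C_k_on (Suc k) S f \<longleftrightarrow>
     (\<forall>x\<in>S. f differentiable (at x)) \<and> (\<forall>v. C_k_on k S (\<lambda>x. frechet_derivative f (at x) v))"

definition smooth_on :: "'a::real_normed_vector set \<Rightarrow> ('a \<Rightarrow> 'b::real_normed_vector) \<Rightarrow> bool" where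
  "smooth_on S f \<longleftrightarrow> (\<forall>k. C_k_on k S f)"

definition diffeomorphism ::
    "'a::euclidean_space set \<Rightarrow> 'b::euclidean_space set \<Rightarrow> ('a \<Rightarrow> 'b) \<Rightarrow> bool" where
  "diffeomorphism U V f \<longleftrightarrow>
     open U \<and> open V \<and> (\<exists>g. homeomorphism U V f g \<and> smooth_on U f \<and> smooth_on V g)"

definition smooth_submanifold :: "int \<Rightarrow> 'a::euclidean_space set \<Rightarrow> bool" where
  "smooth_submanifold k M \<longleftrightarrow>
     (\<forall>p\<in>M. \<exists>U (V :: 'a set) f S. p \<in> U \<and> diffeomorphism U V f \<and>
        subspace S \<and> int (dim S) = k \<and> f ` (U \<inter> M) = V \<inter> S)"

text \<open>The plane is identified with \<^typ>\<open>complex\<close>. A configuration whose initial vertex is the origin is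
  recorded by its edge vectors \<open>z\<^sub>i = x\<^sub>i\<^sub>+\<^sub>1 - x\<^sub>i\<close>, where \<open>z\<^sub>i\<close> is \<open>d\<^sub>i\<close> times \<open>exp (\<i> \<theta>\<^sub>i)\<close>. The vertices are
  the partial sums; the terminal vertex is the sum of all edge vectors.\<close>

definition configurations :: "real^'n \<Rightarrow> (complex^'n) set" where
  "configurations d = {z. \<forall>i. norm (z $ i) = d $ i}"

definition terminal_vertex :: "complex^'n \<Rightarrow> complex" where
  "terminal_vertex z = (\<Sum>i\<in>UNIV. z $ i)"

definition config_space ::
    "real^'l \<Rightarrow> real^'n \<Rightarrow> real^'m \<Rightarrow> ((complex^'l) \<times> (complex^'n) \<times> (complex^'m)) set" where
  "config_space d1 d2 d3 =
     {(z1, z2, z3). z1 \<in> configurations d1 \<and> z2 \<in> configurations d2 \<and> z3 \<in> configurations d3 \<and>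
        terminal_vertex z1 = terminal_vertex z2 \<and> terminal_vertex z2 = terminal_vertex z3}"

text \<open>The moduli space is \<open>config_space / SO(2)\<close>, realised as the set of configurations in which the
  first edge of the first linkage (index \<open>1\<close>) lies on the positive \<open>x\<close>-axis. The lemmas below justify
  this: normalising the first edge is a topological quotient map onto the moduli space whose fibres
  are exactly the \<open>SO(2)\<close>-orbits.\<close>

definition moduli_space ::
    "real^'l::{finite,one} \<Rightarrow> real^'n \<Rightarrow> real^'m
      \<Rightarrow> ((complex^'l::{finite,one}) \<times> (complex^'n) \<times> (complex^'m)) set" where
  "moduli_space d1 d2 d3 =
     {(z1, z2, z3) \<in> config_space d1 d2 d3. Im (z1 $ 1) = 0 \<and> Re (z1 $ 1) > 0}"

definition rotate ::
    "complex \<Rightarrow> (complex^'l) \<times> (complex^'n) \<times> (complex^'m)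
      \<Rightarrow> (complex^'l) \<times> (complex^'n) \<times> (complex^'m)" where
  "rotate u = (\<lambda>(z1, z2, z3). (\<chi> i. u * z1 $ i, \<chi> i. u * z2 $ i, \<chi> i. u * z3 $ i))"

definition normalise ::
    "(complex^'l::{finite,one}) \<times> (complex^'n) \<times> (complex^'m)
      \<Rightarrow> (complex^'l::{finite,one}) \<times> (complex^'n) \<times> (complex^'m)" where
  "normalise p = rotate (cnj (sgn (fst p $ 1))) p"

lemma rotate_rotate: "rotate u (rotate v p) = rotate (u * v) p"
  by (cases p) (simp add: rotate_def mult.assoc)

lemma rotate_one [simp]: "rotate 1 p = p"
  by (cases p) (simp add: rotate_def vec_eq_iff)

lemma fst_rotate [simp]: "fst (rotate u p) $ i = u * fst p $ i"
  by (cases p) (simp add: rotate_def)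

lemma rotate_config_space:
  assumes "norm u = 1" "p \<in> config_space d1 d2 d3"
  shows "rotate u p \<in> config_space d1 d2 d3"
  using assms
  by (auto simp: rotate_def config_space_def configurations_def terminal_vertex_def norm_mult
      simp flip: sum_distrib_left)

lemma cnj_sgn_mult_sgn:
  assumes "z \<noteq> 0" shows "cnj (sgn z) * sgn z = 1"
  using assms by (metis complex_mod_mult_cnj complex_mod_cnj complex_norm_square mult.commute
      norm_sgn of_real_1 power_one)

lemma config_space_first_nonzero:
  assumes "p \<in> config_space d1 d2 d3" "0 < d1 $ i"
  shows "fst p $ i \<noteq> 0"
proof -
  have "norm (fst p $ i) = d1 $ i"
    using assms(1) by (auto simp: config_space_def configurations_def)
  with assms(2) show ?thesis by auto
qed

lemma normalise_rotate:
  assumes "norm u = 1"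
  shows "normalise (rotate u p) = normalise p"
proof -
  have "cnj u * u = 1"
    using assms by (metis complex_norm_square mult.commute of_real_1 power_one)
  moreover have "sgn u = u" using assms by (simp add: sgn_eq)
  ultimately have "cnj (sgn (u * fst p $ 1)) * u = cnj (sgn (fst p $ 1))"
    by (simp add: sgn_mult mult.commute mult.left_commute)
  then show ?thesis by (simp add: normalise_def rotate_rotate)
qed

lemma normalise_in_moduli_space:
  assumes "p \<in> config_space d1 d2 d3" "0 < d1 $ 1"
  shows "normalise p \<in> moduli_space d1 d2 d3"
proof -
  let ?z = "fst p $ 1"
  have nz: "?z \<noteq> 0" using config_space_first_nonzero assms by blast
  then have "norm (cnj (sgn ?z)) = 1" by (simp add: norm_sgn)
  then have C: "normalise p \<in> config_space d1 d2 d3"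
    unfolding normalise_def using assms rotate_config_space by blast
  have "cnj (sgn ?z) * ?z = cnj (sgn ?z) * (sgn ?z * of_real (norm ?z))"
    using nz by (simp add: sgn_eq)
  also have "\<dots> = of_real (norm ?z)"
    using cnj_sgn_mult_sgn[OF nz] by (simp flip: mult.assoc)
  finally have "fst (normalise p) $ 1 = of_real (norm ?z)" by (simp add: normalise_def)
  with C nz show ?thesis by (cases "normalise p") (simp add: moduli_space_def)
qed

lemma normalise_moduli_space:
  assumes "p \<in> moduli_space d1 d2 d3"
  shows "normalise p = p"
proof -
  have "sgn (fst p $ 1) = 1"
    using assms by (auto simp: moduli_space_def sgn_eq complex_eq_iff cmod_eq_Re)
  then show ?thesis by (simp add: normalise_def)
qed

lemma normalise_eq_iff:
  assumes "p \<in> config_space d1 d2 d3" "q \<in> config_space d1 d2 d3" "0 < d1 $ 1"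
  shows "normalise p = normalise q \<longleftrightarrow> (\<exists>u. norm u = 1 \<and> q = rotate u p)"
proof
  let ?u = "cnj (sgn (fst p $ 1))" and ?v = "sgn (fst q $ 1)"
  assume "normalise p = normalise q"
  then have "rotate ?v (rotate ?u p) = rotate ?v (rotate (cnj ?v) q)"
    by (simp add: normalise_def)
  moreover have nz: "fst p $ 1 \<noteq> 0" "fst q $ 1 \<noteq> 0"
    using config_space_first_nonzero assms by blast+
  then have "?v * cnj ?v = 1" using cnj_sgn_mult_sgn by (metis mult.commute)
  ultimately have "q = rotate (?v * ?u) p" by (simp add: rotate_rotate)
  moreover have "norm (?v * ?u) = 1" using nz by (simp add: norm_mult norm_sgn)
  ultimately show "\<exists>u. norm u = 1 \<and> q = rotate u p" by blast
qed (auto simp: normalise_rotate)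

lemma quotient_map_normalise:
  assumes "0 < d1 $ 1"
  shows "quotient_map (top_of_set (config_space d1 d2 d3)) (top_of_set (moduli_space d1 d2 d3))
           normalise"
proof -
  let ?C = "config_space d1 d2 d3" and ?M = "moduli_space d1 d2 d3"
  have "\<forall>p\<in>?C. fst p $ 1 \<noteq> 0"
    using config_space_first_nonzero[OF _ assms] by blast
  then have "continuous_on ?C normalise"
    unfolding normalise_def rotate_def case_prod_unfold
    by (intro continuous_intros) blast+
  moreover have "normalise ` ?C \<subseteq> ?M"
    using normalise_in_moduli_space assms by blast
  moreover have "?M \<subseteq> ?C" by (auto simp: moduli_space_def)
  moreover have "\<forall>p\<in>?M. normalise p = p" using normalise_moduli_space by blast
  ultimately have "retraction_maps (top_of_set ?C) (top_of_set ?M) normalise id"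
    by (auto simp: retraction_maps_def image_subset_iff simp del: split_paired_All)
  then show ?thesis by (meson retraction_imp_quotient_map retraction_map_def)
qed

text \<open>The set of all \<open>\<plusminus> d\<^sub>1 \<plusminus> \<dots> \<plusminus> d\<^sub>n\<close>, all signs being free.\<close>

definition signed_sums :: "real^'n \<Rightarrow> real set" where
  "signed_sums d = {\<Sum>i\<in>UNIV. e i * d $ i | e. \<forall>i. e i \<in> {-1, 1}}"

end

theory Submission
  imports Defs
begin

text \<open>
  After normalisation the moduli space is a level set of an explicit polynomial map
  (\<open>constraint_map\<close>): it records the first edge of the first linkage, the squared lengths of all
  other edges, and the two differences between the terminal vertices. Source and target have
  dimensions \<open>2n\<^sub>2 + 2n\<^sub>3 + 4\<close> and \<open>n\<^sub>2 + n\<^sub>3 + 7\<close>, so the claim follows from the regular level set theorem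
  once the derivative is shown to be surjective along the level set.

  Surjectivity is checked with Lagrange multipliers (\<open>constraint_map_regular\<close>). Let \<open>\<mu>\<close> and \<open>\<nu>\<close> in the
  plane be the multipliers of the two closing conditions. Varying one edge of the second linkage at
  a time shows that \<open>\<mu>\<close> is a multiple of each of its edges; so if \<open>\<mu> \<noteq> 0\<close>, that linkage is stretched
  along the line of \<open>\<mu>\<close> and the distance \<open>r\<close> from the origin to the common terminal vertex belongs
  to \<open>D\<^sub>2\<close>. In the same way \<open>\<nu> \<noteq> 0\<close> gives \<open>r \<in> D\<^sub>3\<close>. The first linkage forces
  \<open>\<bar>a - b\<bar> \<le> r \<le> a + b\<close>, and under either condition no such \<open>r\<close> lies in \<open>D\<^sub>2 \<inter> D\<^sub>3\<close>, so \<open>\<mu>\<close> and \<open>\<nu>\<close>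
  cannot both be nonzero. If exactly one of them is, varying
  the second edge of the first linkage shows that this edge lies on the same line as the stretched
  linkage; then so does the first edge, hence \<open>r \<in> D\<close>, which is excluded too. With \<open>\<mu> = \<nu> = 0\<close> all
  other multipliers vanish because no edge has length zero.

  The regular level set theorem rests on an inverse function theorem with a smooth inverse, which
  amounts to showing that \<open>x \<mapsto> A(x)\<^sup>-\<^sup>1 v\<close> is \<open>C\<^sup>k\<close> whenever the entries of the invertible operators
  \<open>A(x)\<close> are (\<open>C_k_on_inverse_apply\<close>).
\<close>

section \<open>Calculus of \<open>C\<^sup>k\<close> maps\<close>

lemma C_k_on_cong:
  assumes "open S" "\<And>x. x \<in> S \<Longrightarrow> f x = g x"
  shows "C_k_on k S f \<longleftrightarrow> C_k_on k S g"
  using assms(2)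
proof (induction k arbitrary: f g)
  case 0
  then show ?case by (simp cong: continuous_on_cong)
next
  case (Suc k)
  have D: "(f has_derivative D) (at x) \<longleftrightarrow> (g has_derivative D) (at x)" if "x \<in> S" for x D
    using Suc.prems that \<open>open S\<close> by (metis has_derivative_transform_within_open)
  then have "f differentiable (at x) \<longleftrightarrow> g differentiable (at x)" if "x \<in> S" for x
    using that by (simp add: differentiable_def)
  moreover have "frechet_derivative f (at x) = frechet_derivative g (at x)" if "x \<in> S" for x
    using D that by (simp add: frechet_derivative_def)
  then have "C_k_on k S (\<lambda>x. frechet_derivative f (at x) v) \<longleftrightarrow>
      C_k_on k S (\<lambda>x. frechet_derivative g (at x) v)" for v
    by (intro Suc.IH) simp
  ultimately show ?case by simp
qed

text \<open>The closure properties below go by induction on the order. In the step an explicit formula for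
  the derivative is at hand; this rule accepts it in place of \<^const>\<open>frechet_derivative\<close>.\<close>

lemma C_k_on_SucI:
  assumes "open S" "\<And>x. x \<in> S \<Longrightarrow> (f has_derivative f' x) (at x)"
    and "\<And>v. C_k_on k S (\<lambda>x. f' x v)"
  shows "C_k_on (Suc k) S f"
proof -
  have "frechet_derivative f (at x) = f' x" if "x \<in> S" for x
    using assms(2)[OF that] frechet_derivative_at by metis
  then have "C_k_on k S (\<lambda>x. frechet_derivative f (at x) v)" for v
    using assms(1,3) by (subst C_k_on_cong[where g = "\<lambda>x. f' x v"]) auto
  then show ?thesis
    using assms(2) by (auto simp: differentiable_def)
qed

lemma C_k_on_Suc_has_derivative:
  assumes "C_k_on (Suc k) S f" "x \<in> S"
  shows "(f has_derivative frechet_derivative f (at x)) (at x)"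
  using assms by (simp flip: frechet_derivative_works)

lemma C_k_on_Suc_lower:
  assumes "C_k_on (Suc k) S f"
  shows "C_k_on k S f"
  using assms
proof (induction k arbitrary: f)
  case 0
  then show ?case
    by (auto intro: differentiable_imp_continuous_within continuous_at_imp_continuous_on)
next
  case (Suc k)
  then show ?case by (metis C_k_on.simps(2))
qed

lemma C_k_on_imp_continuous_on:
  "C_k_on k S f \<Longrightarrow> continuous_on S f"
proof (induction k)
  case (Suc k)
  then show ?case using C_k_on_Suc_lower by blast
qed simp

lemma C_k_on_subset:
  "C_k_on k S f \<Longrightarrow> T \<subseteq> S \<Longrightarrow> C_k_on k T f"
proof (induction k arbitrary: f)
  case (Suc k)
  then show ?case by (metis C_k_on.simps(2) subsetD)
qed (auto intro: continuous_on_subset)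

lemma C_k_on_const: "open S \<Longrightarrow> C_k_on k S (\<lambda>x. c)"
proof (induction k arbitrary: c)
  case (Suc k)
  then show ?case by (intro C_k_on_SucI[where f' = "\<lambda>x v. 0"]) auto
qed auto

lemma C_k_on_linear:
  assumes "open S" "bounded_linear L"
  shows "C_k_on k S L"
proof (cases k)
  case 0
  then show ?thesis using assms(2) by (simp add: linear_continuous_on)
next
  case (Suc k)
  then show ?thesis
    using C_k_on_SucI[OF assms(1), of L "\<lambda>x. L"] C_k_on_const assms
      bounded_linear_imp_has_derivative by blast
qed

lemma C_k_on_linear_compose:
  assumes "open S" "bounded_linear L" "C_k_on k S f"
  shows "C_k_on k S (\<lambda>x. L (f x))"
  using assms(3)
proof (induction k arbitrary: f)
  case 0
  then show ?case
    using assms(2) by (simp add: bounded_linear.continuous_on)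
next
  case (Suc k)
  have "((\<lambda>x. L (f x)) has_derivative (\<lambda>v. L (frechet_derivative f (at x) v))) (at x)"
    if "x \<in> S" for x
    using bounded_linear.has_derivative[OF assms(2) C_k_on_Suc_has_derivative[OF Suc.prems that]] .
  moreover have "C_k_on k S (\<lambda>x. L (frechet_derivative f (at x) v))" for v
    using Suc.prems by (intro Suc.IH) simp
  ultimately show ?case
    by (intro C_k_on_SucI[OF assms(1)])
qed

lemma C_k_on_add:
  assumes "open S" "C_k_on k S f" "C_k_on k S g"
  shows "C_k_on k S (\<lambda>x. f x + g x)"
  using assms(2,3)
proof (induction k arbitrary: f g)
  case 0
  then show ?case by (simp add: continuous_on_add)
next
  case (Suc k)
  note d = Suc.prems[THEN C_k_on_Suc_has_derivative]
  have "C_k_on k S (\<lambda>x. frechet_derivative f (at x) v + frechet_derivative g (at x) v)" for v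
    using Suc.prems by (intro Suc.IH) simp_all
  with has_derivative_add[OF d] show ?case
    by (intro C_k_on_SucI[OF assms(1)])
qed

lemma C_k_on_sum:
  assumes "open S" "\<And>i. i \<in> I \<Longrightarrow> C_k_on k S (f i)"
  shows "C_k_on k S (\<lambda>x. \<Sum>i\<in>I. f i x)"
  using assms(2)
proof (induction I rule: infinite_finite_induct)
  case (insert i I)
  then show ?case by (simp add: C_k_on_add[OF assms(1)])
qed (simp_all add: C_k_on_const assms(1))

lemma C_k_on_bilinear:
  fixes b :: "_ \<Rightarrow> _ \<Rightarrow> _"
  assumes "bounded_bilinear b" "open S" "C_k_on k S f" "C_k_on k S g"
  shows "C_k_on k S (\<lambda>x. b (f x) (g x))"
  using assms(3,4)
proof (induction k arbitrary: f g)
  case 0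
  then show ?case by (simp add: bounded_bilinear.continuous_on[OF assms(1)])
next
  case (Suc k)
  note d = Suc.prems[THEN C_k_on_Suc_has_derivative]
  have "C_k_on k S (\<lambda>x. frechet_derivative f (at x) v)"
    "C_k_on k S (\<lambda>x. frechet_derivative g (at x) v)" for v
    using Suc.prems by simp_all
  then have "C_k_on k S (\<lambda>x. b (f x) (frechet_derivative g (at x) v)
                          + b (frechet_derivative f (at x) v) (g x))" for v
    by (intro C_k_on_add[OF assms(2)] Suc.IH Suc.prems[THEN C_k_on_Suc_lower])
  with bounded_bilinear.FDERIV[OF assms(1) d] show ?case
    by (intro C_k_on_SucI[OF assms(2)])
qed

lemma linear_basis_expansion:
  fixes L :: "'a::euclidean_space \<Rightarrow> 'b::real_vector"
  assumes "linear L"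
  shows "L v = (\<Sum>e\<in>Basis. (v \<bullet> e) *\<^sub>R L e)"
proof -
  have "(\<Sum>e\<in>Basis. (v \<bullet> e) *\<^sub>R L e) = L (\<Sum>e\<in>Basis. (v \<bullet> e) *\<^sub>R e)"
    by (simp add: linear_sum[OF assms] linear_scale[OF assms])
  then show ?thesis
    by (simp only: euclidean_representation)
qed

text \<open>Directional derivatives are handled one direction at a time, but the chain rule evaluates a
  derivative in a direction that varies with the point. Expanding that direction in the standard
  basis reduces the second situation to the first.\<close>

lemma C_k_on_scaleR_coordinates:
  fixes f :: "'c::real_normed_vector \<Rightarrow> 'a::euclidean_space"
    and g :: "'a \<Rightarrow> 'c \<Rightarrow> 'b::real_normed_vector"
  assumes "open S" "C_k_on k S f" "\<And>e. C_k_on k S (g e)"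
  shows "C_k_on k S (\<lambda>x. \<Sum>e\<in>Basis. (f x \<bullet> e) *\<^sub>R g e x)"
proof (rule C_k_on_sum[OF assms(1)])
  fix e :: 'a
  have "C_k_on k S (\<lambda>x. f x \<bullet> e)"
    using C_k_on_linear_compose[OF assms(1) bounded_linear_inner_left assms(2)] .
  then show "C_k_on k S (\<lambda>x. (f x \<bullet> e) *\<^sub>R g e x)"
    using C_k_on_bilinear[OF bounded_bilinear_scaleR assms(1)] assms(3) by blast
qed

lemma C_k_on_apply:
  fixes A :: "'c::real_normed_vector \<Rightarrow> 'a::euclidean_space \<Rightarrow> 'b::real_normed_vector"
  assumes "open S" "\<And>x. x \<in> S \<Longrightarrow> linear (A x)"
    and "\<And>e. C_k_on k S (\<lambda>x. A x e)" "C_k_on k S f"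
  shows "C_k_on k S (\<lambda>x. A x (f x))"
proof -
  have "C_k_on k S (\<lambda>x. \<Sum>e\<in>Basis. (f x \<bullet> e) *\<^sub>R A x e)"
    by (rule C_k_on_scaleR_coordinates[OF assms(1,4,3)])
  moreover have "A x (f x) = (\<Sum>e\<in>Basis. (f x \<bullet> e) *\<^sub>R A x e)" if "x \<in> S" for x
    by (rule linear_basis_expansion) (rule assms(2)[OF that])
  ultimately show ?thesis
    by (subst C_k_on_cong[OF assms(1)]) auto
qed

lemma C_k_on_compose:
  fixes f :: "'c::real_normed_vector \<Rightarrow> 'a::euclidean_space"
    and g :: "'a \<Rightarrow> 'b::real_normed_vector"
  assumes "open S" "f ` S \<subseteq> T" "C_k_on k S f" "C_k_on k T g"
  shows "C_k_on k S (\<lambda>x. g (f x))"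
  using assms(3,4)
proof (induction k arbitrary: g)
  case 0
  then show ?case
    using assms(2) by (auto intro: continuous_on_compose2)
next
  case (Suc k)
  let ?A = "\<lambda>x. frechet_derivative g (at (f x))"
  have dg: "(g has_derivative ?A x) (at (f x))" if "x \<in> S" for x
    using C_k_on_Suc_has_derivative[OF Suc.prems(2)] assms(2) that by blast
  have "((\<lambda>x. g (f x)) has_derivative (\<lambda>v. ?A x (frechet_derivative f (at x) v))) (at x)"
    if "x \<in> S" for x
    using has_derivative_compose[OF C_k_on_Suc_has_derivative[OF Suc.prems(1) that] dg[OF that]] .
  moreover have "C_k_on k S (\<lambda>x. ?A x (frechet_derivative f (at x) v))" for v
  proof (rule C_k_on_apply[OF assms(1)])
    show "linear (?A x)" if "x \<in> S" for x
      using dg[OF that] has_derivative_linear by blast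
    show "C_k_on k S (\<lambda>x. ?A x e)" for e
      using Suc.prems(2) by (intro Suc.IH[OF C_k_on_Suc_lower[OF Suc.prems(1)]]) simp
    show "C_k_on k S (\<lambda>x. frechet_derivative f (at x) v)"
      using Suc.prems(1) by simp
  qed
  ultimately show ?case
    by (intro C_k_on_SucI[OF assms(1)])
qed

section \<open>Smooth inverse function theorem\<close>

text \<open>If \<open>A(y)\<close> stretches every vector at least by the factor \<open>m\<close>, then \<open>A(x)\<close> stretches at least by
  \<open>m/2\<close> for \<open>x\<close> near \<open>y\<close>. With \<open>h(x) = A(x)\<^sup>-\<^sup>1 v\<close> we have \<open>A(x) (h(x) - h(y)) = v - A(x) h(y)\<close>, which
  tends to \<open>0\<close>, and the lower bound carries this over to \<open>h(x) - h(y)\<close>.\<close>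

lemma continuous_inverse_apply:
  fixes A :: "'c::t2_space \<Rightarrow> 'a::euclidean_space \<Rightarrow> 'a"
  assumes "\<And>x. x \<in> S \<Longrightarrow> linear (A x)" "\<And>x. x \<in> S \<Longrightarrow> bij (A x)"
    and "\<And>e. continuous_on S (\<lambda>x. A x e)"
  shows "continuous_on S (\<lambda>x. inv (A x) v)"
  unfolding continuous_on_eq_continuous_within continuous_within
proof
  fix y assume "y \<in> S"
  let ?h = "\<lambda>x. inv (A x) v"
  obtain m where "m > 0" and m: "\<And>u. m * norm u \<le> norm (A y u)"
    using linear_inj_bounded_below_pos[of "A y"] assms(1,2)[OF \<open>y \<in> S\<close>]
    by (metis bij_is_inj)
  have lim: "((\<lambda>x. A x e) \<longlongrightarrow> A y e) (at y within S)" for e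
    using assms(3)[of e] \<open>y \<in> S\<close> by (simp add: continuous_on_def)
  have "((\<lambda>x. \<Sum>e\<in>Basis. norm (A x e - A y e)) \<longlongrightarrow> (\<Sum>e\<in>(Basis::'a set). norm (A y e - A y e)))
          (at y within S)"
    by (intro tendsto_intros lim)
  then have "\<forall>\<^sub>F x in at y within S. (\<Sum>e\<in>Basis. norm (A x e - A y e)) < m/2"
    using \<open>m > 0\<close> by (intro order_tendstoD(2)[of _ 0]) auto
  moreover have "\<forall>\<^sub>F x in at y within S. x \<in> S"
    by (simp add: eventually_at_filter)
  ultimately have "\<forall>\<^sub>F x in at y within S. norm (?h x - ?h y) \<le> 2/m * norm (v - A x (?h y))"
  proof eventually_elim
    case (elim x)
    have lx: "linear (A x)" and ly: "linear (A y)" using assms(1) elim \<open>y \<in> S\<close> by auto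
    define u where "u = ?h x - ?h y"
    have "norm (A x u - A y u) = norm (\<Sum>e\<in>Basis. (u \<bullet> e) *\<^sub>R (A x e - A y e))"
      using linear_basis_expansion[OF lx, of u] linear_basis_expansion[OF ly, of u]
      by (simp add: scaleR_diff_right sum_subtractf)
    also have "\<dots> \<le> (\<Sum>e\<in>Basis. norm u * norm (A x e - A y e))"
      by (intro sum_norm_le) (auto intro!: mult_right_mono Basis_le_norm)
    also have "\<dots> \<le> norm u * (m/2)"
      unfolding sum_distrib_left[symmetric] using elim(1) by (intro mult_left_mono) auto
    finally have "norm (A x u - A y u) \<le> norm u * (m/2)" .
    moreover have "norm (A y u) \<le> norm (A x u) + norm (A x u - A y u)"
      by (metis norm_minus_commute norm_triangle_sub)
    ultimately have "m/2 * norm u \<le> norm (A x u)"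
      using m[of u] by (simp add: field_simps)
    moreover have "A x u = v - A x (?h y)"
      using lx assms(2) elim by (simp add: u_def linear_diff bij_is_surj surj_f_inv_f)
    ultimately have "m/2 * norm u \<le> norm (v - A x (?h y))" by simp
    then show ?case
      unfolding u_def[symmetric] using \<open>m > 0\<close> by (simp add: field_simps)
  qed
  moreover have "((\<lambda>x. 2/m * norm (v - A x (?h y))) \<longlongrightarrow> 0) (at y within S)"
  proof -
    have "A y (?h y) = v"
      using assms(2)[OF \<open>y \<in> S\<close>] by (simp add: bij_is_surj surj_f_inv_f)
    then have "((\<lambda>x. 2/m * norm (v - A x (?h y))) \<longlongrightarrow> 2/m * norm (v - v)) (at y within S)"
      using lim[of "?h y"] by (intro tendsto_intros) simp
    then show ?thesis by simp
  qed
  ultimately have "((\<lambda>x. ?h x - ?h y) \<longlongrightarrow> 0) (at y within S)"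
    by (rule Lim_null_comparison)
  then show "(?h \<longlongrightarrow> ?h y) (at y within S)"
    by (simp add: LIM_zero_iff)
qed

text \<open>A factor that vanishes at the point makes continuity of the other factor sufficient for a
  product rule. This bootstraps differentiability of inverse operators from their continuity.\<close>

lemma has_derivative_scaleR_vanishing:
  fixes f :: "'a::real_normed_vector \<Rightarrow> real" and c :: "'a \<Rightarrow> 'b::real_normed_vector"
  assumes "(f has_derivative f') (at y)" "f y = 0" "isCont c y"
  shows "((\<lambda>x. f x *\<^sub>R c x) has_derivative (\<lambda>v. f' v *\<^sub>R c y)) (at y)"
proof -
  have bl: "bounded_linear f'" using assms(1) has_derivative_bounded_linear by blast
  then obtain K where K: "\<And>v. norm (f' v) \<le> norm v * K" "K > 0"
    using bounded_linear.pos_bounded by blast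
  let ?r = "\<lambda>x. (f x - f' (x - y)) /\<^sub>R norm (x - y)"
  have lim: "(?r \<longlongrightarrow> 0) (at y)"
    using assms(1,2) by (simp add: has_derivative_at_within has_derivative_iff_norm
        tendsto_norm_zero_iff divide_inverse mult.commute)
  have c: "(c \<longlongrightarrow> c y) (at y)" using assms(3) by (simp add: isCont_def)
  \<comment> \<open>The difference quotient splits into the remainder of \<open>f\<close> times \<open>c\<close> and a bounded factor times
    the increment of \<open>c\<close>; both tend to \<open>0\<close>.\<close>
  have "((\<lambda>x. ?r x *\<^sub>R c x + (f' (x - y) / norm (x - y)) *\<^sub>R (c x - c y)) \<longlongrightarrow> 0 *\<^sub>R c y + 0) (at y)"
  proof (intro tendsto_add tendsto_scaleR lim c)
    have "\<forall>\<^sub>F x in at y. norm ((f' (x - y) / norm (x - y)) *\<^sub>R (c x - c y)) \<le> K * norm (c x - c y)"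
    proof (intro always_eventually allI)
      fix x
      have "\<bar>f' (x - y)\<bar> / norm (x - y) \<le> K"
        using K(1)[of "x - y"] K(2) by (cases "x = y") (auto simp: field_simps)
      then show "norm ((f' (x - y) / norm (x - y)) *\<^sub>R (c x - c y)) \<le> K * norm (c x - c y)"
        unfolding norm_scaleR real_norm_def abs_divide abs_norm_cancel
        by (rule mult_right_mono) simp
    qed
    moreover have "((\<lambda>x. K * norm (c x - c y)) \<longlongrightarrow> 0) (at y)"
      using c by (intro tendsto_mult_right_zero tendsto_norm_zero) (simp add: LIM_zero_iff)
    ultimately show "((\<lambda>x. (f' (x - y) / norm (x - y)) *\<^sub>R (c x - c y)) \<longlongrightarrow> 0) (at y)"
      by (rule Lim_null_comparison)
  qed
  then have "((\<lambda>x. (f x *\<^sub>R c x - f' (x - y) *\<^sub>R c y) /\<^sub>R norm (x - y)) \<longlongrightarrow> 0) (at y)"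
    by (simp add: algebra_simps divide_inverse)
  then show ?thesis
    using assms(2) bl
    by (simp add: has_derivative_at_within algebra_simps bounded_linear_scaleR_const)
qed

text \<open>The induction feeds on itself. For \<open>h(x) = A(x)\<^sup>-\<^sup>1 v\<close> the identity
  \<open>h(x) = h(y) - A(x)\<^sup>-\<^sup>1 (A(x) h(y) - v)\<close> has a bracket that vanishes at \<open>x = y\<close>, so differentiating at
  \<open>y\<close> gives \<open>h'(y) w = - A(y)\<^sup>-\<^sup>1 ((A'(y) w) h(y))\<close>. The right-hand side is built from \<open>A'\<close>, from \<open>h\<close>
  and from \<open>A\<^sup>-\<^sup>1\<close> applied to the basis vectors. To know that the latter are \<open>C\<^sup>k\<close> when \<open>h\<close> is to be
  \<open>C\<^sup>k\<^sup>+\<^sup>1\<close>, the vector \<open>v\<close> has to be arbitrary in the induction.\<close>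

lemma C_k_on_inverse_apply:
  fixes A :: "'c::real_normed_vector \<Rightarrow> 'a::euclidean_space \<Rightarrow> 'a"
  assumes "open S" "\<And>x. x \<in> S \<Longrightarrow> linear (A x)" "\<And>x. x \<in> S \<Longrightarrow> bij (A x)"
    and "\<And>e. C_k_on k S (\<lambda>x. A x e)"
  shows "C_k_on k S (\<lambda>x. inv (A x) v)"
  using assms(4)
proof (induction k arbitrary: v)
  case 0
  then show ?case
    using continuous_inverse_apply[of S A] assms(2,3) by simp
next
  case (Suc k)
  let ?h = "\<lambda>x. inv (A x) v"
  let ?d = "\<lambda>y w e. frechet_derivative (\<lambda>x. A x e) (at y) w"
  \<comment> \<open>\<open>(A'(y) w) h(y)\<close>, expanded along the standard basis\<close>
  let ?D = "\<lambda>y w. \<Sum>e\<in>Basis. (?h y \<bullet> e) *\<^sub>R ?d y w e"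
  have lin_inv: "linear (inv (A x))" if "x \<in> S" for x
    using inj_linear_imp_inv_linear bij_is_inj that assms(2,3) by blast
  have IH: "C_k_on k S (\<lambda>x. inv (A x) u)" for u
    by (rule Suc.IH) (rule C_k_on_Suc_lower[OF Suc.prems])
  have "(?h has_derivative (\<lambda>w. - inv (A y) (?D y w))) (at y)" if "y \<in> S" for y
  proof -
    have Ah: "A y (?h y) = v"
      using assms(3)[OF that] by (simp add: bij_is_surj surj_f_inv_f)
    have "((\<lambda>x. \<Sum>e\<in>Basis. (?h y \<bullet> e) *\<^sub>R A x e) has_derivative ?D y) (at y)"
      by (intro has_derivative_sum has_derivative_scaleR_right
          C_k_on_Suc_has_derivative[OF Suc.prems that])
    then have "((\<lambda>x. A x (?h y)) has_derivative ?D y) (at y)"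
      by (rule has_derivative_transform_within_open[OF _ assms(1) that])
        (simp flip: linear_basis_expansion add: assms(2))
    then have "((\<lambda>x. (A x (?h y) - v) \<bullet> e) has_derivative (\<lambda>w. ?D y w \<bullet> e)) (at y)" for e
      by (auto intro!: derivative_eq_intros)
    moreover have "isCont (\<lambda>x. inv (A x) e) y" for e
      using C_k_on_imp_continuous_on[OF IH] assms(1) that
      by (simp add: continuous_on_eq_continuous_at)
    ultimately have "((\<lambda>x. ?h y - (\<Sum>e\<in>Basis. ((A x (?h y) - v) \<bullet> e) *\<^sub>R inv (A x) e))
        has_derivative (\<lambda>w. 0 - (\<Sum>e\<in>Basis. (?D y w \<bullet> e) *\<^sub>R inv (A y) e))) (at y)"
      by (intro has_derivative_diff has_derivative_const has_derivative_sum
          has_derivative_scaleR_vanishing) (simp_all add: Ah)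
    then have "(?h has_derivative (\<lambda>w. 0 - (\<Sum>e\<in>Basis. (?D y w \<bullet> e) *\<^sub>R inv (A y) e))) (at y)"
    proof (rule has_derivative_transform_within_open[OF _ assms(1) that])
      fix x assume "x \<in> S"
      have "(\<Sum>e\<in>Basis. ((A x (?h y) - v) \<bullet> e) *\<^sub>R inv (A x) e) = inv (A x) (A x (?h y) - v)"
        by (rule linear_basis_expansion[OF lin_inv[OF \<open>x \<in> S\<close>], symmetric])
      also have "\<dots> = ?h y - ?h x"
        using lin_inv[OF \<open>x \<in> S\<close>] assms(3)[OF \<open>x \<in> S\<close>] by (simp add: linear_diff bij_is_inj)
      finally show "?h y - (\<Sum>e\<in>Basis. ((A x (?h y) - v) \<bullet> e) *\<^sub>R inv (A x) e) = ?h x" by simp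
    qed
    then show ?thesis
      by (simp flip: linear_basis_expansion[OF lin_inv[OF that]])
  qed
  moreover have "C_k_on k S (\<lambda>y. - inv (A y) (?D y w))" for w
  proof -
    have "C_k_on k S (\<lambda>y. ?d y w e)" for e
      using Suc.prems by simp
    then have "C_k_on k S (\<lambda>y. ?D y w)"
      by (intro C_k_on_scaleR_coordinates assms(1) IH)
    then have "C_k_on k S (\<lambda>y. inv (A y) (?D y w))"
      by (intro C_k_on_apply[where A = "\<lambda>y. inv (A y)" and f = "\<lambda>y. ?D y w"]
            assms(1) lin_inv IH)
    then show ?thesis
      by (rule C_k_on_linear_compose[OF assms(1) bounded_linear_minus[OF bounded_linear_ident]])
  qed
  ultimately show ?case
    by (intro C_k_on_SucI[OF assms(1)])
qed

text \<open>The derivative of \<open>g\<close> at \<open>y\<close> is the inverse of \<open>f'(g(y))\<close>, and this depends on \<open>y\<close> in a \<open>C\<^sup>k\<close>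
  manner as soon as \<open>g\<close> does. So each order of smoothness of \<open>g\<close> yields the next one.\<close>

lemma smooth_on_inverse:
  fixes f :: "'a::euclidean_space \<Rightarrow> 'a"
  assumes "open V" "smooth_on U f" "g ` V \<subseteq> U"
    and bij: "\<And>y. y \<in> V \<Longrightarrow> bij (frechet_derivative f (at (g y)))"
    and der: "\<And>y. y \<in> V \<Longrightarrow> (g has_derivative inv (frechet_derivative f (at (g y)))) (at y)"
  shows "smooth_on V g"
  unfolding smooth_on_def
proof
  fix k
  show "C_k_on k V g"
  proof (induction k)
    case 0
    then show ?case
      using der by (auto intro!: continuous_at_imp_continuous_on has_derivative_continuous)
  next
    case (Suc k)
    have f: "C_k_on (Suc k) U f" using assms(2) unfolding smooth_on_def by blast
    have "C_k_on k V (\<lambda>y. inv (frechet_derivative f (at (g y))) v)" for v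
    proof (rule C_k_on_inverse_apply[OF assms(1) _ bij])
      show "linear (frechet_derivative f (at (g y)))" if "y \<in> V" for y
        using C_k_on_Suc_has_derivative[OF f] assms(3) that has_derivative_linear by blast
      show "C_k_on k V (\<lambda>y. frechet_derivative f (at (g y)) e)" for e
        using f by (intro C_k_on_compose[OF assms(1,3) Suc]) simp
    qed
    then show ?case
      by (intro C_k_on_SucI[OF assms(1) der])
  qed
qed

theorem smooth_inverse_function_theorem:
  fixes f :: "'a::euclidean_space \<Rightarrow> 'a"
  assumes "open W" "smooth_on W f" "p \<in> W" "(f has_derivative D) (at p)" "bij D"
  obtains U V where "p \<in> U" "U \<subseteq> W" "diffeomorphism U V f"
proof -
  let ?d = "\<lambda>x. frechet_derivative f (at x)"
  define f' where "f' = (\<lambda>x. Blinfun (?d x))"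
  have C1: "C_k_on (Suc 0) W f" using assms(2) unfolding smooth_on_def by blast
  have der: "(f has_derivative ?d x) (at x)" if "x \<in> W" for x
    using C_k_on_Suc_has_derivative[OF C1 that] .
  have f': "blinfun_apply (f' x) = ?d x" if "x \<in> W" for x
    unfolding f'_def using der[OF that] has_derivative_bounded_linear bounded_linear_Blinfun_apply
    by blast
  have linD: "linear D" using assms(4) has_derivative_linear by blast
  have D: "D = ?d p" using frechet_derivative_at[OF assms(4)] .
  have "linear (inv D)" using inj_linear_imp_inv_linear[OF linD bij_is_inj[OF assms(5)]] .
  then have iD: "blinfun_apply (Blinfun (inv D)) = inv D"
    by (simp add: bounded_linear_Blinfun_apply linear_conv_bounded_linear)
  have "continuous_on W f'"
  proof (rule continuous_on_blinfun_componentwise)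
    fix e :: 'a
    have "continuous_on W (\<lambda>x. ?d x e)" using C1 by simp
    then show "continuous_on W (\<lambda>x. blinfun_apply (f' x) e)"
      by (simp add: f' cong: continuous_on_cong)
  qed
  moreover have "Blinfun (inv D) o\<^sub>L f' p = id_blinfun"
    by (rule blinfun_eqI) (simp add: iD f' assms(3,5) bij_is_inj flip: D)
  ultimately obtain U V g g' where UV: "open U" "U \<subseteq> W" "p \<in> U" "open V" "homeomorphism U V f g"
    and g: "\<And>y. y \<in> V \<Longrightarrow> (g has_derivative (g' y)) (at y)"
      "\<And>y. y \<in> V \<Longrightarrow> g' y = inv (blinfun_apply (f' (g y)))"
      "\<And>y. y \<in> V \<Longrightarrow> bij (blinfun_apply (f' (g y)))"
    using inverse_function_theorem[of W f f' p "Blinfun (inv D)"] assms(1,3) der f' by metis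
  have gV: "g ` V = U" using UV(5) by (simp add: homeomorphism_def)
  then have gW: "g y \<in> W" if "y \<in> V" for y using that UV(2) by blast
  have smU: "smooth_on U f"
    using assms(2) UV(2) C_k_on_subset unfolding smooth_on_def by blast
  have "smooth_on V g"
    using g f'[OF gW] gV by (intro smooth_on_inverse[OF UV(4) smU]) auto
  with UV smU have "diffeomorphism U V f"
    unfolding diffeomorphism_def by blast
  with UV show thesis using that by blast
qed

section \<open>Regular level sets\<close>

text \<open>The whole space is the direct sum of the kernel of \<open>A\<close> and the image of the right inverse \<open>R\<close>.\<close>

lemma dim_kernel_surjective:
  fixes A :: "'a::euclidean_space \<Rightarrow> 'b::euclidean_space"
  assumes "linear A" "linear R" "\<And>y. A (R y) = y"
  shows "dim {x. A x = 0} + DIM('b) = DIM('a)"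
proof -
  have K: "subspace {x. A x = 0}" by (rule linear_subspace_kernel[OF assms(1)])
  have R: "subspace (range R)" by (simp add: assms(2) linear_subspace_image)
  have "inj R" using assms(3) by (metis injI)
  then have 1: "dim (range R) = DIM('b)"
    using dim_image_eq[OF assms(2), of UNIV] by (simp add: inj_on_subset)
  have 2: "{x. A x = 0} \<inter> range R = {0}"
  proof
    show "{x. A x = 0} \<inter> range R \<subseteq> {0}"
      using assms(3) linear_0[OF assms(2)] by auto
    show "{0} \<subseteq> {x. A x = 0} \<inter> range R"
      using linear_0[OF assms(1)] subspace_0[OF R] by auto
  qed
  have 3: "{x + y |x y. x \<in> {x. A x = 0} \<and> y \<in> range R} = UNIV"
  proof -
    have "z \<in> {x + y |x y. x \<in> {x. A x = 0} \<and> y \<in> range R}" for z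
    proof (intro CollectI exI conjI)
      show "z = (z - R (A z)) + R (A z)" by simp
      show "A (z - R (A z)) = 0" using assms by (simp add: linear_diff)
      show "R (A z) \<in> range R" by simp
    qed
    then show ?thesis by blast
  qed
  show ?thesis
    using dim_sums_Int[OF K R] unfolding 1 2 3 by simp
qed

lemma smooth_on_add:
  "open S \<Longrightarrow> smooth_on S f \<Longrightarrow> smooth_on S g \<Longrightarrow> smooth_on S (\<lambda>x. f x + g x)"
  unfolding smooth_on_def by (intro allI C_k_on_add) auto

lemma smooth_on_linear: "open S \<Longrightarrow> bounded_linear L \<Longrightarrow> smooth_on S L"
  unfolding smooth_on_def by (intro allI C_k_on_linear)

lemma smooth_on_const: "open S \<Longrightarrow> smooth_on S (\<lambda>x. c)"
  unfolding smooth_on_def by (intro allI C_k_on_const)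

text \<open>Let \<open>A\<close> be the derivative at \<open>p\<close> and \<open>R\<close> a right inverse of \<open>A\<close>. The slice chart at \<open>p\<close> is
  \<open>G(x) = (x - p) + R (F(x) - c - A (x - p))\<close>. Its derivative at \<open>p\<close> is the identity, since the
  bracket vanishes to first order, and \<open>A (G(x)) = F(x) - c\<close> because \<open>A R = id\<close>. Thus \<open>G\<close> maps the
  level set exactly into the kernel of \<open>A\<close>.\<close>

theorem regular_level_set_submanifold:
  fixes F :: "'a::euclidean_space \<Rightarrow> 'b::euclidean_space"
  assumes "open W" "smooth_on W F"
    and reg: "\<And>p. p \<in> W \<Longrightarrow> F p = c \<Longrightarrow> surj (frechet_derivative F (at p))"
  shows "smooth_submanifold (int DIM('a) - int DIM('b)) {p \<in> W. F p = c}"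
  unfolding smooth_submanifold_def
proof
  fix p assume "p \<in> {p \<in> W. F p = c}"
  then have p: "p \<in> W" "F p = c" by auto
  define A where "A = frechet_derivative F (at p)"
  have "C_k_on (Suc 0) W F" using assms(2) unfolding smooth_on_def by blast
  then have dF: "(F has_derivative A) (at p)"
    unfolding A_def using C_k_on_Suc_has_derivative p(1) by blast
  then have linA: "linear A" using has_derivative_linear by blast
  obtain R where linR: "linear R" and "A \<circ> R = id"
    using linear_surjective_right_inverse[OF linA] reg[OF p] by (auto simp: A_def)
  then have AR: "A (R y) = y" for y by (metis comp_apply id_apply)
  have blA: "bounded_linear A" and blR: "bounded_linear R"
    using linA linR by (simp_all add: linear_conv_bounded_linear)
  define S where "S = {x. A x = 0}"
  have S: "subspace S" "int (dim S) = int DIM('a) - int DIM('b)"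
    using dim_kernel_surjective[OF linA linR AR] linear_subspace_kernel[OF linA]
    by (simp_all add: S_def)
  define G where "G = (\<lambda>x. R (F x) + (x - R (A x)) + (R (A p) - R c - p))"
  have "smooth_on W (\<lambda>x. R (F x))"
    using assms(2) C_k_on_linear_compose[OF assms(1) blR] by (simp add: smooth_on_def)
  then have "smooth_on W G"
    unfolding G_def
    by (intro smooth_on_add[OF assms(1)] smooth_on_const[OF assms(1)])
      (auto intro!: smooth_on_linear assms(1) bounded_linear_sub
        bounded_linear_ident bounded_linear_compose[OF blR blA])
  moreover have "(G has_derivative (\<lambda>v. R (A v) + (v - R (A v)) + 0)) (at p)"
    unfolding G_def
    by (intro has_derivative_add has_derivative_diff has_derivative_const has_derivative_ident
        bounded_linear.has_derivative[OF blR] dF bounded_linear_imp_has_derivative[OF blA])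
  then have "(G has_derivative (\<lambda>v. v)) (at p)" by simp
  ultimately obtain U V where UV: "p \<in> U" "U \<subseteq> W" "diffeomorphism U V G"
    using smooth_inverse_function_theorem[OF assms(1) _ p(1)] bij_id[unfolded id_def] by metis
  have AG: "A (G x) = F x - c" for x
    using linA by (simp add: G_def linear_add linear_diff AR)
  have "G ` U = V"
    using UV(3) by (auto simp: diffeomorphism_def homeomorphism_def)
  then have "G ` (U \<inter> {p \<in> W. F p = c}) = V \<inter> S"
    using UV(2) AG by (auto simp: S_def image_iff)
  with UV S show "\<exists>U (V :: 'a set) f S. p \<in> U \<and> diffeomorphism U V f \<and> subspace S \<and>
      int (dim S) = int DIM('a) - int DIM('b) \<and> f ` (U \<inter> {p \<in> W. F p = c}) = V \<inter> S"
    by blast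
qed

text \<open>A proper subspace of the target has a nonzero orthogonal vector, that is, a nontrivial vector
  of Lagrange multipliers.\<close>

lemma linear_surj_if_no_multiplier:
  fixes A :: "'a::euclidean_space \<Rightarrow> 'b::euclidean_space"
  assumes "linear A" "\<And>y. (\<And>v. A v \<bullet> y = 0) \<Longrightarrow> y = 0"
  shows "surj A"
proof (rule ccontr)
  assume "\<not> surj A"
  moreover have "subspace (range A)" by (simp add: assms(1) linear_subspace_image)
  ultimately have "dim (range A) < DIM('b)"
    by (metis dim_UNIV dim_subset_UNIV order_le_imp_less_or_eq subspace_UNIV subspace_dim_equal
        subset_UNIV order_refl)
  then obtain y where "y \<noteq> 0" "\<And>x. x \<in> span (range A) \<Longrightarrow> orthogonal y x"
    using orthogonal_to_subspace_exists by blast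
  then have "A v \<bullet> y = 0" for v
    by (metis orthogonal_def inner_commute rangeI span_base)
  with assms(2) \<open>y \<noteq> 0\<close> show False by blast
qed

section \<open>Stretched configurations\<close>

lemma signed_sums_uminus:
  assumes "s \<in> signed_sums d" shows "- s \<in> signed_sums d"
proof -
  obtain e where e: "s = (\<Sum>i\<in>UNIV. e i * d $ i)" "\<forall>i. e i \<in> {-1, 1}"
    using assms by (auto simp: signed_sums_def)
  then have "- s = (\<Sum>i\<in>UNIV. - e i * d $ i)" "\<forall>i. - e i \<in> {-1, 1}"
    by (auto simp: sum_negf)
  then show ?thesis
    unfolding signed_sums_def by (intro CollectI exI[of _ "\<lambda>i. - e i"]) simp
qed

lemma signed_sums_abs: "s \<in> signed_sums d \<Longrightarrow> \<bar>s\<bar> \<in> signed_sums d"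
  by (simp add: abs_if signed_sums_uminus)

text \<open>Each edge is parallel to \<open>u\<close>, hence equals plus or minus its length times the unit vector of
  \<open>u\<close>; the signs are those of the factors \<open>t i\<close>.\<close>

lemma terminal_vertex_collinear:
  assumes "z \<in> configurations d" "u \<noteq> 0" "\<And>i. u = t i *\<^sub>R z $ i"
  shows "\<exists>s\<in>signed_sums d. terminal_vertex z = s *\<^sub>R sgn u"
proof
  have z: "z $ i = (sgn (t i) * d $ i) *\<^sub>R sgn u" for i
  proof -
    have d: "d $ i = norm (z $ i)" using assms(1) by (simp add: configurations_def)
    have "t i \<noteq> 0" using assms(2) assms(3)[of i] by auto
    then have "sgn (t i) * d $ i * sgn (t i) = d $ i" by (simp add: sgn_real_def)
    then have "(sgn (t i) * d $ i) *\<^sub>R sgn u = d $ i *\<^sub>R sgn (z $ i)"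
      by (subst assms(3)[of i]) (simp add: sgn_scaleR)
    also have "\<dots> = z $ i"
      by (cases "z $ i = 0") (simp_all add: d sgn_div_norm)
    finally show ?thesis ..
  qed
  have "sgn (t i) \<in> {-1, 1}" for i
    using assms(2) assms(3)[of i] by (auto simp: sgn_real_def)
  then show "(\<Sum>i\<in>UNIV. sgn (t i) * d $ i) \<in> signed_sums d"
    unfolding signed_sums_def by (intro CollectI exI[of _ "\<lambda>i. sgn (t i)"]) simp
  show "terminal_vertex z = (\<Sum>i\<in>UNIV. sgn (t i) * d $ i) *\<^sub>R sgn u"
    unfolding terminal_vertex_def scaleR_sum_left using z by simp
qed

section \<open>The moduli space as a regular level set\<close>

text \<open>The map cutting out the moduli space is split into its linear part and its quadratic part, the
  latter given by a symmetric bilinear form. Smoothness and the derivative then come for free.\<close>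

definition closing_map ::
    "(complex^2) \<times> (complex^'n) \<times> (complex^'m)
      \<Rightarrow> complex \<times> real \<times> (real^'n) \<times> (real^'m) \<times> complex \<times> complex" where
  "closing_map = (\<lambda>(z1, z2, z3). (z1 $ 1, 0, 0, 0,
     terminal_vertex z1 - terminal_vertex z2, terminal_vertex z1 - terminal_vertex z3))"

definition length_form ::
    "(complex^2) \<times> (complex^'n) \<times> (complex^'m) \<Rightarrow> (complex^2) \<times> (complex^'n) \<times> (complex^'m)
      \<Rightarrow> complex \<times> real \<times> (real^'n) \<times> (real^'m) \<times> complex \<times> complex" where
  "length_form = (\<lambda>(z1, z2, z3) (w1, w2, w3).
     (0, z1 $ 2 \<bullet> w1 $ 2, \<chi> i. z2 $ i \<bullet> w2 $ i, \<chi> i. z3 $ i \<bullet> w3 $ i, 0, 0))"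

definition constraint_map ::
    "(complex^2) \<times> (complex^'n) \<times> (complex^'m)
      \<Rightarrow> complex \<times> real \<times> (real^'n) \<times> (real^'m) \<times> complex \<times> complex" where
  "constraint_map p = closing_map p + length_form p p"

lemma linear_terminal_vertex: "linear terminal_vertex"
  by (rule linearI) (simp_all add: terminal_vertex_def sum.distrib scaleR_sum_right)

lemma linear_closing_map: "linear closing_map"
  by (rule linearI)
    (auto simp: closing_map_def linear_add[OF linear_terminal_vertex]
      linear_scale[OF linear_terminal_vertex] algebra_simps)

lemma bilinear_length_form: "bilinear length_form"
  unfolding bilinear_def
  by (intro conjI allI linearI)
    (auto simp: length_form_def inner_add_left inner_add_right vec_eq_iff)

lemma length_form_commute: "length_form p q = length_form q p"
  by (auto simp: length_form_def inner_commute split: prod.splits)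

lemma smooth_constraint_map: "smooth_on UNIV constraint_map"
proof -
  have "C_k_on k UNIV (\<lambda>p. closing_map p + length_form p p)" for k
    using linear_closing_map bilinear_length_form
    by (intro C_k_on_add C_k_on_bilinear[of length_form] C_k_on_linear open_UNIV
        bounded_linear_ident)
      (simp_all add: linear_conv_bounded_linear bilinear_conv_bounded_bilinear)
  then show ?thesis
    unfolding smooth_on_def constraint_map_def[abs_def] by blast
qed

lemma constraint_map_derivative:
  "frechet_derivative constraint_map (at p) v = closing_map v + 2 *\<^sub>R length_form p v"
proof -
  have bb: "bounded_bilinear length_form" and bl: "bounded_linear closing_map"
    using linear_closing_map bilinear_length_form
    by (simp_all add: linear_conv_bounded_linear bilinear_conv_bounded_bilinear)
  have "(constraint_map has_derivative (\<lambda>v. closing_map v + (length_form p v + length_form v p)))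
      (at p)"
    unfolding constraint_map_def[abs_def]
    by (intro has_derivative_add bounded_linear_imp_has_derivative[OF bl]
        bounded_bilinear.FDERIV[OF bb] has_derivative_ident)
  from frechet_derivative_at[OF this, symmetric] show ?thesis
    by (simp add: length_form_commute[of v p] scaleR_2)
qed

text \<open>Fixing the first edge to be the number \<open>a\<close> encodes its length and its direction at once. For the
  other edges the squared length determines the length because all lengths are positive.\<close>

lemma moduli_space_eq_level_set:
  fixes d2 :: "real^'n" and d3 :: "real^'m"
  assumes "a > 0" "b > 0" "\<forall>j. d2 $ j > 0" "\<forall>j. d3 $ j > 0"
  shows "moduli_space (vector [a, b] :: real^2) d2 d3 =
    {p. constraint_map p =
      (of_real a, b\<^sup>2, \<chi> j. (d2 $ j)\<^sup>2, \<chi> j. (d3 $ j)\<^sup>2, 0, 0)}"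
proof -
  have norm_iff: "norm z = r \<longleftrightarrow> z \<bullet> z = r\<^sup>2" if "r > 0" for z :: complex and r
    using that by (metis less_imp_le norm_ge_zero power2_eq_iff_nonneg power2_norm_eq_inner)
  have first_iff: "norm z = a \<and> Im z = 0 \<and> Re z > 0 \<longleftrightarrow> z = of_real a" for z
    using assms(1) by (auto simp: complex_eq_iff cmod_eq_Re)
  have "(z1, z2, z3) \<in> moduli_space (vector [a, b]) d2 d3 \<longleftrightarrow>
      constraint_map (z1, z2, z3) =
        (of_real a, b\<^sup>2, \<chi> j. (d2 $ j)\<^sup>2, \<chi> j. (d3 $ j)\<^sup>2, 0, 0)"
    for z1 :: "complex^2" and z2 :: "complex^'n" and z3 :: "complex^'m"
  proof -
    have "(z1, z2, z3) \<in> moduli_space (vector [a, b]) d2 d3 \<longleftrightarrow>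
        (norm (z1 $ 1) = a \<and> Im (z1 $ 1) = 0 \<and> Re (z1 $ 1) > 0) \<and> norm (z1 $ 2) = b \<and>
        (\<forall>j. norm (z2 $ j) = d2 $ j) \<and> (\<forall>j. norm (z3 $ j) = d3 $ j) \<and>
        terminal_vertex z1 = terminal_vertex z2 \<and> terminal_vertex z1 = terminal_vertex z3"
      by (auto simp: moduli_space_def config_space_def configurations_def forall_2 vector_2)
    then show ?thesis
      unfolding first_iff using assms(2-4)
      by (auto simp: norm_iff constraint_map_def closing_map_def length_form_def vec_eq_iff)
  qed
  then show ?thesis by auto
qed

lemma norm_terminal_vertex_collinear:
  assumes "z \<in> configurations d" "u \<noteq> 0" "\<And>i. u = t i *\<^sub>R z $ i"
  shows "norm (terminal_vertex z) \<in> signed_sums d"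
proof -
  obtain s where "s \<in> signed_sums d" "terminal_vertex z = s *\<^sub>R sgn u"
    using terminal_vertex_collinear[OF assms] by blast
  then show ?thesis
    using assms(2) by (simp add: norm_sgn signed_sums_abs)
qed

text \<open>If the second edge and the endpoint of a two-edge chain lie on the line of \<open>u\<close>, then so does the
  first edge, and the chain is either stretched out or folded back.\<close>

lemma collinear_terminal_norm:
  assumes "norm x = a" "norm y = b" "x + y = s *\<^sub>R sgn u" "u = t *\<^sub>R y" "u \<noteq> 0"
  shows "norm (x + y) \<in> {\<bar>a - b\<bar>, a + b}"
proof -
  have "y = inverse t *\<^sub>R u" using assms(4,5) by auto
  moreover have "u = norm u *\<^sub>R sgn u" using assms(5) by (simp add: sgn_div_norm)
  ultimately have "y = (inverse t * norm u) *\<^sub>R sgn u"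
    by (metis scaleR_scaleR)
  then obtain c where c: "y = c *\<^sub>R sgn u" by blast
  then have x: "x = (s - c) *\<^sub>R sgn u"
    using assms(3) by (simp add: algebra_simps)
  have "norm (sgn u) = 1" using assms(5) by (simp add: norm_sgn)
  then have "\<bar>c\<bar> = b" "\<bar>s - c\<bar> = a" "norm (x + y) = \<bar>s\<bar>"
    using assms(1-3) c x by auto
  then have "norm (x + y) = \<bar>a - b\<bar> \<or> norm (x + y) = a + b" by linarith
  then show ?thesis by blast
qed

text \<open>The multiplier argument. The components of \<open>y\<close> are tested against variations of a single edge
  vector, which affects only the constraint on that edge and the closing conditions. Equilibrium of
  forces is a helpful picture: \<open>\<mu>\<close> and \<open>\<nu>\<close> are the tensions carried by the second and the third
  linkage, and a freely rotating edge can only transmit a force along itself.\<close>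

lemma constraint_map_regular:
  fixes d2 :: "real^'n" and d3 :: "real^'m"
  assumes "b > 0" "\<forall>j. d2 $ j > 0" "\<forall>j. d3 $ j > 0"
    and D2: "{\<bar>a - b\<bar>, a + b} \<inter> signed_sums d2 = {}"
    and D3: "{\<bar>a - b\<bar>, a + b} \<inter> signed_sums d3 = {}"
    and D23: "{\<bar>a - b\<bar>..a + b} \<inter> (signed_sums d2 \<inter> signed_sums d3) = {}"
    and p: "p \<in> moduli_space (vector [a, b] :: real^2) d2 d3"
  shows "surj (frechet_derivative constraint_map (at p))"
proof (rule linear_surj_if_no_multiplier)
  have "C_k_on (Suc 0) UNIV constraint_map"
    using smooth_constraint_map unfolding smooth_on_def by blast
  then show "linear (frechet_derivative constraint_map (at p))"
    using C_k_on_Suc_has_derivative has_derivative_linear by blast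
next
  fix y assume orth: "\<And>v. frechet_derivative constraint_map (at p) v \<bullet> y = 0"
  obtain z1 z2 z3 where p_eq: "p = (z1, z2, z3)" by (cases p) auto
  obtain \<alpha> \<beta> \<gamma> \<delta> \<mu> \<nu> where y_eq: "y = (\<alpha>, \<beta>, \<gamma>, \<delta>, \<mu>, \<nu>)" by (cases y) auto
  have conf: "z1 \<in> configurations (vector [a, b])" "z2 \<in> configurations d2"
      "z3 \<in> configurations d3"
    and tv: "terminal_vertex z1 = terminal_vertex z2" "terminal_vertex z1 = terminal_vertex z3"
    using p by (auto simp: p_eq moduli_space_def config_space_def)
  have n: "norm (z1 $ 1) = a" "norm (z1 $ 2) = b"
    using conf(1) by (simp_all add: configurations_def forall_2 vector_2)
  have tv1: "terminal_vertex z1 = z1 $ 1 + z1 $ 2"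
    by (simp add: terminal_vertex_def UNIV_2)
  have tv_axis: "terminal_vertex (axis i x) = x" for i :: "'k::finite" and x
    by (simp add: terminal_vertex_def axis_def)
  have tv_0: "terminal_vertex 0 = 0"
    by (simp add: terminal_vertex_def)
  have in_axis: "(\<chi> j. z $ j \<bullet> axis i x $ j) \<bullet> w = (z $ i \<bullet> x) * w $ i"
    for i :: "'k::finite" and x :: complex and z w
  proof -
    have "(\<chi> j. z $ j \<bullet> axis i x $ j) \<bullet> w = (\<Sum>j\<in>UNIV. if j = i then (z $ i \<bullet> x) * w $ i else 0)"
      unfolding inner_vec_def by (intro sum.cong) (auto simp: axis_def)
    then show ?thesis by simp
  qed
  have axis_2: "axis 1 x $ (1::2) = x" "axis 1 x $ (2::2) = 0" "axis 2 x $ (1::2) = 0"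
      "axis 2 x $ (2::2) = x" for x :: complex
    by (simp_all add: axis_def)
  note simps = p_eq y_eq constraint_map_derivative closing_map_def length_form_def
    tv_axis tv_0 in_axis axis_2 zero_vec_def[symmetric] inner_add_left inner_diff_left algebra_simps
  have zero: "w = 0" if "\<And>x. w \<bullet> x = 0" for w :: complex
    using that[of w] by simp
  have \<alpha>: "\<alpha> + \<mu> + \<nu> = 0"
  proof (rule zero)
    fix x show "(\<alpha> + \<mu> + \<nu>) \<bullet> x = 0"
      using orth[of "(axis 1 x, 0, 0)"] by (simp add: simps inner_commute[of x])
  qed
  have \<beta>: "\<mu> + \<nu> = (- (2 * \<beta>)) *\<^sub>R z1 $ 2"
  proof -
    have "(2 * \<beta>) *\<^sub>R z1 $ 2 + \<mu> + \<nu> = 0"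
    proof (rule zero)
      fix x show "((2 * \<beta>) *\<^sub>R z1 $ 2 + \<mu> + \<nu>) \<bullet> x = 0"
        using orth[of "(axis 2 x, 0, 0)"] by (simp add: simps inner_commute[of x])
    qed
    then show ?thesis by (simp add: add.assoc add_eq_0_iff)
  qed
  have \<mu>: "\<mu> = (2 * \<gamma> $ i) *\<^sub>R z2 $ i" for i
  proof -
    have "(2 * \<gamma> $ i) *\<^sub>R z2 $ i - \<mu> = 0"
    proof (rule zero)
      fix x show "((2 * \<gamma> $ i) *\<^sub>R z2 $ i - \<mu>) \<bullet> x = 0"
        using orth[of "(0, axis i x, 0)"] by (simp add: simps inner_commute[of x])
    qed
    then show ?thesis by simp
  qed
  have \<nu>: "\<nu> = (2 * \<delta> $ i) *\<^sub>R z3 $ i" for i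
  proof -
    have "(2 * \<delta> $ i) *\<^sub>R z3 $ i - \<nu> = 0"
    proof (rule zero)
      fix x show "((2 * \<delta> $ i) *\<^sub>R z3 $ i - \<nu>) \<bullet> x = 0"
        using orth[of "(0, 0, axis i x)"] by (simp add: simps inner_commute[of x])
    qed
    then show ?thesis by simp
  qed
  have P2: "norm (terminal_vertex z1) \<in> signed_sums d2" if "\<mu> \<noteq> 0"
    using norm_terminal_vertex_collinear[OF conf(2) that \<mu>] tv by simp
  have P3: "norm (terminal_vertex z1) \<in> signed_sums d3" if "\<nu> \<noteq> 0"
    using norm_terminal_vertex_collinear[OF conf(3) that \<nu>] tv by simp
  have range: "norm (terminal_vertex z1) \<in> {\<bar>a - b\<bar>..a + b}"
    unfolding tv1 using norm_triangle_ineq[of "z1 $ 1" "z1 $ 2"]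
      norm_triangle_ineq3[of "z1 $ 1" "- z1 $ 2"] by (simp add: n)
  have not_both: "\<mu> = 0 \<or> \<nu> = 0"
    using P2 P3 range D23 by blast
  have \<mu>0: "\<mu> = 0"
  proof (rule ccontr)
    assume nz: "\<mu> \<noteq> 0"
    then have "\<nu> = 0" using not_both by blast
    then have "\<mu> = (- (2 * \<beta>)) *\<^sub>R z1 $ 2"
      using \<beta> by simp
    moreover obtain s where "terminal_vertex z2 = s *\<^sub>R sgn \<mu>"
      using terminal_vertex_collinear[OF conf(2) nz \<mu>] by blast
    ultimately have "norm (terminal_vertex z1) \<in> {\<bar>a - b\<bar>, a + b}"
      using collinear_terminal_norm[OF n] nz tv tv1 by metis
    then show False using P2[OF nz] D2 by blast
  qed
  have \<nu>0: "\<nu> = 0"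
  proof (rule ccontr)
    assume nz: "\<nu> \<noteq> 0"
    then have "\<nu> = (- (2 * \<beta>)) *\<^sub>R z1 $ 2"
      using \<beta> \<mu>0 by simp
    moreover obtain s where "terminal_vertex z3 = s *\<^sub>R sgn \<nu>"
      using terminal_vertex_collinear[OF conf(3) nz \<nu>] by blast
    ultimately have "norm (terminal_vertex z1) \<in> {\<bar>a - b\<bar>, a + b}"
      using collinear_terminal_norm[OF n] nz tv tv1 by metis
    then show False using P3[OF nz] D3 by blast
  qed
  have "z1 $ 2 \<noteq> 0" using n(2) assms(1) by auto
  moreover have "z2 $ i \<noteq> 0" for i
    using conf(2) assms(2)
    by (metis (mono_tags) configurations_def less_irrefl mem_Collect_eq norm_zero)
  moreover have "z3 $ i \<noteq> 0" for i
    using conf(3) assms(3)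
    by (metis (mono_tags) configurations_def less_irrefl mem_Collect_eq norm_zero)
  ultimately have "\<alpha> = 0" "\<beta> = 0" "\<gamma> = 0" "\<delta> = 0"
    using \<alpha> \<beta> \<mu> \<nu> \<mu>0 \<nu>0 by (simp_all add: vec_eq_iff)
  with \<mu>0 \<nu>0 show "y = 0"
    by (simp add: y_eq zero_prod_def)
qed

theorem theorem5p6:
  fixes a b :: real and d2 :: "real^'n" and d3 :: "real^'m" and D2 D3 D :: "real set"
  assumes "a > 0" and "b > 0" and "\<forall>j. d2 $ j > 0" and "\<forall>j. d3 $ j > 0"
    and "D2 = signed_sums d2" and "D3 = signed_sums d3" and "D = {\<bar>a - b\<bar>, a + b}"
    and "a + b < min (\<Sum>j\<in>UNIV. d2 $ j) (\<Sum>j\<in>UNIV. d3 $ j)"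
    and "(D2 \<inter> D3 = {} \<and> D2 \<inter> D = {} \<and> D3 \<inter> D = {}) \<or>
         (D2 \<inter> D3 \<noteq> {} \<and> {\<bar>a - b\<bar>..a + b} \<inter> (D2 \<inter> D3) = {} \<and> D \<inter> (D2 \<union> D3) = {})"
  shows "smooth_submanifold (int CARD('n) + int CARD('m) - 3)
           (moduli_space (vector [a, b] :: real^2) d2 d3)"
proof -
  let ?c = "(of_real a, b\<^sup>2, \<chi> j. (d2 $ j)\<^sup>2, \<chi> j. (d3 $ j)\<^sup>2, 0, 0)
    :: complex \<times> real \<times> (real^'n) \<times> (real^'m) \<times> complex \<times> complex"
  have disj: "{\<bar>a - b\<bar>, a + b} \<inter> signed_sums d2 = {}" "{\<bar>a - b\<bar>, a + b} \<inter> signed_sums d3 = {}"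
    "{\<bar>a - b\<bar>..a + b} \<inter> (signed_sums d2 \<inter> signed_sums d3) = {}"
    using assms(9) unfolding assms(5-7) by blast+
  have M: "moduli_space (vector [a, b]) d2 d3 = {p \<in> UNIV. constraint_map p = ?c}"
    using moduli_space_eq_level_set[OF assms(1-4)] by simp
  have "smooth_submanifold (int DIM((complex^2) \<times> (complex^'n) \<times> (complex^'m)) -
      int DIM(complex \<times> real \<times> (real^'n) \<times> (real^'m) \<times> complex \<times> complex))
      {p \<in> UNIV. constraint_map p = ?c}"
  proof (rule regular_level_set_submanifold[OF open_UNIV smooth_constraint_map])
    fix p :: "(complex^2) \<times> (complex^'n) \<times> (complex^'m)"
    assume "constraint_map p = ?c"
    then have "p \<in> moduli_space (vector [a, b]) d2 d3" using M by blast
    then show "surj (frechet_derivative constraint_map (at p))"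
      by (rule constraint_map_regular[OF assms(2-4) disj])
  qed
  then show ?thesis
    by (simp add: M)
qed

end
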